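(* Let $\mathcal{S}$ be a closed disk of center $S_0$ and radius $R_0>0$ contained in a plane $\mathcal{P}\subset\mathbb{R}^3$, let $X$ be uniformly distributed in $\mathcal{S}$, let $P\in\mathbb{R}^3$, let $P_0$ be the orthogonal projection of $P$ onto $\mathcal{P}$, and set $D=\|\overrightarrow{PX}\|_2$. Put $\delta=\|\overrightarrow{PP_0}\|_2$, $R_1=\|\overrightarrow{S_0P_0}\|_2$, $d_{\min}=\sqrt{\delta^2+(R_0-R_1)^2}$, $d_{\max}=\sqrt{\delta^2+(R_0+R_1)^2}$ and, for $d\ge\delta$, $R(d)=\sqrt{d^2-\delta^2}$. With the functions $\mathbb{A}$, $\partial_R\mathbb{A}$, $\partial_h\mathbb{A}$ given in the context, and when $R_1>0$, $$h_1=R(d)-R_1+\frac{R_0^2+R_1^2-R(d)^2}{2R_1},\qquad h_2=R_0-\frac{R_0^2+R_1^2-R(d)^2}{2R_1},$$ $$G(d)=\frac{\mathbb{A}(R(d),h_1)+\mathbb{A}(R_0,h_2)}{\pi R_0^2},$$ $$g(d)=\frac{1}{\pi R_0^2}\left[\frac{d}{R_1}\,\partial_h\mathbb{A}(R_0,h_2)+\frac{d}{R(d)}\,\partial_R\mathbb{A}(R(d),h_1)+d\left(\frac{1}{R(d)}-\frac{1}{R_1}\right)\partial_h\mathbb{A}(R(d),h_1)\right],$$ the cumulative distribution function $F_D$ of $D$ and a probability density $f_D$ of $D$ are as follows. (1) If $R_1=0$: $F_D(d)=f_D(d)=0$ for $d<\delta$; $F_D(d)=\frac{d^2-\delta^2}{R_0^2}$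 and $f_D(d)=\frac{2d}{R_0^2}$ for $\delta\le d\le\sqrt{\delta^2+R_0^2}$; $F_D(d)=1$ and $f_D(d)=0$ for $d>\sqrt{\delta^2+R_0^2}$. (2) If $0<R_1<R_0$: $F_D(d)=f_D(d)=0$ for $d<\delta$; $F_D(d)=\frac{d^2-\delta^2}{R_0^2}$ and $f_D(d)=\frac{2d}{R_0^2}$ for $\delta\le d\le d_{\min}$; $F_D(d)=G(d)$ and $f_D(d)=g(d)$ for $d_{\min}<d\le d_{\max}$; $F_D(d)=1$ and $f_D(d)=0$ for $d>d_{\max}$. (3) If $R_1\ge R_0$: $F_D(d)=f_D(d)=0$ for $d<d_{\min}$; $F_D(d)=G(d)$ and $f_D(d)=g(d)$ for $d_{\min}\le d\le d_{\max}$; $F_D(d)=1$ and $f_D(d)=0$ for $d>d_{\max}$. (If $R_1=R_0$ and $d=d_{\min}=\delta$, so that $R(d)=0$, the value of $G$ is understood as $0$, and the value of the density at this single point is irrelevant.)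
   Context: "Uniformly distributed in $\mathcal{S}$" means with respect to two-dimensional area measure on the plane $\mathcal{P}$ restricted to $\mathcal{S}$ and normalized. $F_D(d)=\mathbb{P}(D\le d)$. A probability density of $D$ is a nonnegative function $f_D$ with $F_D(d)=\int_{-\infty}^d f_D(t)\,dt$ for all $d\in\mathbb{R}$ (it is determined up to a Lebesgue-null set). For $R>0$ and $0\le h\le 2R$, $\mathbb{A}(R,h)$ is the area of the circular segment ("lens") of height $h$ in a disk of radius $R$: $$\mathbb{A}(R,h)=R^2\arccos\left(\frac{R-h}{R}\right)-(R-h)\sqrt{R^2-(R-h)^2},$$ and its partial derivatives are given by $$\partial_R\mathbb{A}(R,h)=2R\arccos\left(1-\frac hR\right)-2\sqrt{h(2R-h)},\qquad \partial_h\mathbb{A}(R,h)=2\sqrt{h(2R-h)}.$$ *)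

theory Defs
  imports "HOL-Probability.Probability"
begin

section \<open>Area measure on a plane in three-space\<close>

definition is_plane :: "(real^3) set \<Rightarrow> bool" where
  "is_plane Pl \<longleftrightarrow> affine Pl \<and> aff_dim Pl = 2"

definition plane_chart :: "(real^2 \<Rightarrow> real^3) \<Rightarrow> (real^3) set \<Rightarrow> bool" where
  "plane_chart \<phi> Pl \<longleftrightarrow> (\<forall>x y. dist (\<phi> x) (\<phi> y) = dist x y) \<and> range \<phi> = Pl"

text \<open>Two-dimensional Lebesgue measure transported to the plane by an isometric parametrization.
  By \<open>plane_chart_exists\<close> and \<open>plane_area_eq\<close> below there is such a parametrization and the
  measure does not depend on which one is chosen.\<close>

definition plane_area :: "(real^3) set \<Rightarrow> (real^3) measure" where
  "plane_area Pl = distr lborel borel (SOME \<phi>. plane_chart \<phi> Pl)"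

lemma plane_chart_exists:
  assumes "is_plane Pl"
  shows "\<exists>\<phi>. plane_chart \<phi> Pl"
proof -
  have aff: "affine Pl" and d2: "aff_dim Pl = 2"
    using assms by (auto simp: is_plane_def)
  then have "Pl \<noteq> {}" by auto
  then obtain a where a: "a \<in> Pl" by auto
  let ?T = "(\<lambda>x. - a + x) ` Pl"
  have sub: "subspace ?T"
    using affine_diffs_subspace[OF aff a] .
  have "aff_dim ?T = 2"
    using d2 aff_dim_translation_eq[of "-a" Pl] by simp
  then have "int (dim ?T) = 2"
    using aff_dim_subspace[OF sub] by simp
  then have dimT: "dim (UNIV :: (real^2) set) = dim ?T"
    by (simp)
  obtain f g where f: "linear f" "f ` (UNIV :: (real^2) set) = ?T"
      "\<And>x. x \<in> UNIV \<Longrightarrow> norm (f x) = norm x"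
    using isometries_subspaces[OF subspace_UNIV sub dimT] by metis
  let ?\<phi> = "\<lambda>x. a + f x"
  have "\<forall>x y. dist (?\<phi> x) (?\<phi> y) = dist x y"
    using f(3) linear_diff[OF f(1), symmetric] by (simp add: dist_norm)
  moreover have "range ?\<phi> = (\<lambda>y. a + y) ` range f" by auto
  then have "range ?\<phi> = Pl"
    by (simp add: f(2) image_image)
  ultimately show ?thesis
    unfolding plane_chart_def by (intro exI[of _ ?\<phi>]) simp
qed

lemma lborel_distr_orthogonal:
  fixes h :: "real^2 \<Rightarrow> real^2"
  assumes "orthogonal_transformation h"
  shows "distr lborel borel h = lborel"
proof (rule lborel_eqI[symmetric])
  have lin: "linear h" using assms by (rule orthogonal_transformation_linear)
  then have meas [measurable]: "h \<in> borel_measurable borel"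
    by (intro borel_measurable_continuous_onI linear_continuous_on)
       (simp add: linear_conv_bounded_linear)
  have bij: "bij h" using assms by (rule orthogonal_transformation_bij)
  have inv: "orthogonal_transformation (inv h)"
    using assms by (rule orthogonal_transformation_inv)
  fix l u :: "real^2"
  assume lu: "\<And>b. b \<in> Basis \<Longrightarrow> l \<bullet> b \<le> u \<bullet> b"
  have img: "h -` box l u = inv h ` box l u"
    using bij by (simp add: bij_vimage_eq_inv_image)
  have lm: "inv h ` box l u \<in> lmeasurable"
    using measurable_orthogonal_image[OF inv lmeasurable_box] .
  have m: "measure lebesgue (inv h ` box l u) = measure lebesgue (box l u)"
    using measure_orthogonal_image[OF inv lmeasurable_box] .
  have sets: "h -` box l u \<in> sets borel"
    using measurable_sets[OF meas, of "box l u"] by simp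
  have "emeasure (distr lborel borel h) (box l u) = emeasure lborel (h -` box l u)"
    by (subst emeasure_distr) auto
  also have "\<dots> = emeasure lebesgue (h -` box l u)"
    using sets by simp
  also have "\<dots> = ennreal (measure lebesgue (box l u))"
    using lm m by (simp add: img emeasure_eq_measure2)
  also have "\<dots> = ennreal (\<Prod>b\<in>Basis. (u - l) \<bullet> b)"
    using lu by (simp add: measure_lborel_box_eq)
  finally show "emeasure (distr lborel borel h) (box l u) = (\<Prod>b\<in>Basis. (u - l) \<bullet> b)" .
qed simp

lemma lborel_distr_isometry:
  fixes g :: "real^2 \<Rightarrow> real^2"
  assumes "\<And>x y. dist (g x) (g y) = dist x y"
  shows "distr lborel borel g = lborel"
proof -
  let ?h = "\<lambda>x. - g 0 + g x"
  have "orthogonal_transformation ?h"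
    unfolding orthogonal_transformation_isometry using assms by (simp add: dist_norm)
  then have h: "distr lborel borel ?h = lborel" by (rule lborel_distr_orthogonal)
  have [measurable]: "g \<in> borel_measurable borel"
    by (rule borel_measurable_continuous_onI) (auto simp: continuous_on_iff assms)
  have "lborel = distr (distr lborel borel ?h) borel ((+) (g 0))"
    by (simp only: h lborel_distr_plus)
  also have "\<dots> = distr lborel borel ((+) (g 0) \<circ> ?h)"
    by (subst distr_distr) auto
  also have "(+) (g 0) \<circ> ?h = g" by auto
  finally show ?thesis by simp
qed

lemma plane_chart_measurable:
  assumes "plane_chart \<phi> Pl"
  shows "\<phi> \<in> borel_measurable borel"
proof (rule borel_measurable_continuous_onI)
  show "continuous_on UNIV \<phi>"
    unfolding continuous_on_iff using assms by (auto simp: plane_chart_def)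
qed

lemma plane_area_eq:
  assumes \<phi>: "plane_chart \<phi> Pl"
  shows "plane_area Pl = distr lborel borel \<phi>"
proof -
  define \<psi> where "\<psi> = (SOME \<phi>. plane_chart \<phi> Pl)"
  have \<psi>: "plane_chart \<psi> Pl" unfolding \<psi>_def by (rule someI[of "\<lambda>\<phi>. plane_chart \<phi> Pl", OF \<phi>])
  define g where "g = inv \<phi> \<circ> \<psi>"
  have \<phi>g: "\<phi> (g x) = \<psi> x" for x
  proof -
    have "\<psi> x \<in> range \<phi>" using \<phi> \<psi> by (auto simp: plane_chart_def)
    then show ?thesis by (simp add: g_def f_inv_into_f)
  qed
  have iso: "dist (g x) (g y) = dist x y" for x y
  proof -
    have "dist (g x) (g y) = dist (\<phi> (g x)) (\<phi> (g y))"
      using \<phi> by (simp add: plane_chart_def)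
    also have "\<dots> = dist x y" using \<psi> by (simp add: \<phi>g plane_chart_def)
    finally show ?thesis .
  qed
  have g [measurable]: "g \<in> borel_measurable borel"
    by (rule borel_measurable_continuous_onI) (auto simp: continuous_on_iff iso)
  note [measurable] = plane_chart_measurable[OF \<phi>]
  have "distr lborel borel \<phi> = distr (distr lborel borel g) borel \<phi>"
    by (simp add: lborel_distr_isometry[OF iso])
  also have "\<dots> = distr lborel borel (\<phi> \<circ> g)"
    by (subst distr_distr) auto
  also have "\<phi> \<circ> g = \<psi>" using \<phi>g by auto
  finally show ?thesis by (simp add: plane_area_def \<psi>_def)
qed

section \<open>Probability densities\<close>

text \<open>Integrability on every half-line is required because the Bochner integral of a
  non-integrable function is 0 by convention; it also entails that \<open>f\<close> is measurable.\<close>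

definition is_density_of :: "'a measure \<Rightarrow> ('a \<Rightarrow> real) \<Rightarrow> (real \<Rightarrow> real) \<Rightarrow> bool" where
  "is_density_of M D f \<longleftrightarrow> (\<forall>t. 0 \<le> f t) \<and>
     (\<forall>d. set_integrable lborel {..d} f \<and> cdf (distr M borel D) d = (LBINT t:{..d}. f t))"

section \<open>Circular segments\<close>

definition seg_area :: "real \<Rightarrow> real \<Rightarrow> real" where
  "seg_area R h = R\<^sup>2 * arccos ((R - h) / R) - (R - h) * sqrt (R\<^sup>2 - (R - h)\<^sup>2)"

definition seg_area_dR :: "real \<Rightarrow> real \<Rightarrow> real" where
  "seg_area_dR R h = 2 * R * arccos (1 - h / R) - 2 * sqrt (h * (2 * R - h))"

definition seg_area_dh :: "real \<Rightarrow> real \<Rightarrow> real" where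
  "seg_area_dh R h = 2 * sqrt (h * (2 * R - h))"

lemma seg_sqrt:
  assumes "0 < h" "h < 2 * (R::real)"
  shows "sqrt (1 - ((R - h) / R)\<^sup>2) = sqrt (h * (2 * R - h)) / R"
proof -
  have R: "0 < R" using assms by simp
  have "1 - ((R - h) / R)\<^sup>2 = h * (2 * R - h) / R\<^sup>2"
    using R by (simp add: field_simps power2_eq_square)
  then show ?thesis using R by (simp add: real_sqrt_divide)
qed

lemma seg_area_has_derivative_h:
  assumes "0 < h" "h < 2 * R"
  shows "((\<lambda>h. seg_area R h) has_real_derivative seg_area_dh R h) (at h)"
proof -
  have R: "0 < R" using assms by simp
  define s where "s = sqrt (h * (2 * R - h))"
  have s0: "0 < s" and s2: "s * s = h * (2 * R - h)" using assms by (auto simp: s_def)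
  have e: "R\<^sup>2 - (R - h)\<^sup>2 = h * (2 * R - h)" by (simp add: algebra_simps power2_eq_square)
  have b: "-1 < (R - h) / R" "(R - h) / R < 1" using R assms by (auto simp: field_simps)
  have pos: "0 < R\<^sup>2 - (R - h)\<^sup>2" using assms by (simp add: e)
  have "((\<lambda>h. (R - h) / R) has_real_derivative - 1 / R) (at h)"
    using R by (auto intro!: derivative_eq_intros)
  from DERIV_chain2[OF DERIV_arccos[OF b] this]
  have 1: "((\<lambda>h. arccos ((R - h) / R)) has_real_derivative 1 / s) (at h)"
    using R s0 unfolding seg_sqrt[OF assms] s_def[symmetric] by (simp add: field_simps)
  have "((\<lambda>h. R\<^sup>2 - (R - h)\<^sup>2) has_real_derivative 2 * (R - h)) (at h)"
    by (auto intro!: derivative_eq_intros)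
  from DERIV_chain2[OF DERIV_real_sqrt[OF pos] this]
  have 2: "((\<lambda>h. sqrt (R\<^sup>2 - (R - h)\<^sup>2)) has_real_derivative (R - h) / s) (at h)"
    unfolding e s_def[symmetric] by (rule DERIV_cong) (use s0 in \<open>simp add: field_simps\<close>)
  have 3: "((\<lambda>h. R - h) has_real_derivative - 1) (at h)"
    by (auto intro!: derivative_eq_intros)
  have "R\<^sup>2 * (1 / s) - (- 1 * sqrt (R\<^sup>2 - (R - h)\<^sup>2) + (R - h) / s * (R - h)) = 2 * s"
    (is "?l = _")
  proof -
    have "?l = (R\<^sup>2 - (R - h)\<^sup>2) / s + sqrt (R\<^sup>2 - (R - h)\<^sup>2)"
      by (simp add: diff_divide_distrib power2_eq_square left_diff_distrib right_diff_distrib)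
    also have "\<dots> = (R\<^sup>2 - (R - h)\<^sup>2) / s + s" by (simp add: e s_def)
    also have "\<dots> = 2 * s" using s0 by (simp add: e s2[symmetric])
    finally show ?thesis .
  qed
  from DERIV_cong[OF DERIV_diff[OF DERIV_cmult[OF 1, of "R\<^sup>2"] DERIV_mult[OF 3 2]], OF this]
  show ?thesis
    unfolding seg_area_def seg_area_dh_def s_def[symmetric] .
qed

lemma seg_area_has_derivative_R:
  assumes "0 < h" "h < 2 * R"
  shows "((\<lambda>R. seg_area R h) has_real_derivative seg_area_dR R h) (at R)"
proof -
  have R: "0 < R" using assms by simp
  define s where "s = sqrt (h * (2 * R - h))"
  have s0: "0 < s" and s2: "s * s = h * (2 * R - h)" using assms by (auto simp: s_def)
  have e: "R\<^sup>2 - (R - h)\<^sup>2 = h * (2 * R - h)" by (simp add: algebra_simps power2_eq_square)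
  have b: "-1 < (R - h) / R" "(R - h) / R < 1" using R assms by (auto simp: field_simps)
  have pos: "0 < R\<^sup>2 - (R - h)\<^sup>2" using assms by (simp add: e)
  have a: "1 - h / R = (R - h) / R" using R by (simp add: field_simps)
  have "((\<lambda>R. (R - h) / R) has_real_derivative h / R\<^sup>2) (at R)"
    using R by (auto intro!: derivative_eq_intros simp: field_simps power2_eq_square)
  from DERIV_chain2[OF DERIV_arccos[OF b] this]
  have 1: "((\<lambda>R. arccos ((R - h) / R)) has_real_derivative - (h / (R * s))) (at R)"
    using R s0 unfolding seg_sqrt[OF assms] s_def[symmetric]
    by (simp add: field_simps power2_eq_square)
  have "((\<lambda>R. R\<^sup>2 - (R - h)\<^sup>2) has_real_derivative 2 * h) (at R)"
    by (auto intro!: derivative_eq_intros)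
  from DERIV_chain2[OF DERIV_real_sqrt[OF pos] this]
  have 2: "((\<lambda>R. sqrt (R\<^sup>2 - (R - h)\<^sup>2)) has_real_derivative h / s) (at R)"
    using s0 unfolding e s_def[symmetric] by (simp add: field_simps)
  have 3: "((\<lambda>R. R - h) has_real_derivative 1) (at R)"
    by (auto intro!: derivative_eq_intros)
  have 4: "((\<lambda>R. R\<^sup>2) has_real_derivative 2 * R) (at R)"
    by (auto intro!: derivative_eq_intros)
  have "2 * R * arccos ((R - h) / R) + - (h / (R * s)) * R\<^sup>2
      - (1 * sqrt (R\<^sup>2 - (R - h)\<^sup>2) + h / s * (R - h))
      = 2 * R * arccos ((R - h) / R) - 2 * s" (is "?l = _")
  proof -
    have "?l = 2 * R * arccos ((R - h) / R) - s - (h * (2 * R - h)) / s"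
      unfolding e s_def[symmetric] using s0 R
      by (simp add: power2_eq_square add_divide_distrib diff_divide_distrib right_diff_distrib)
    also have "(h * (2 * R - h)) / s = s" using s0 by (simp add: s2[symmetric])
    finally show ?thesis by simp
  qed
  from DERIV_cong[OF DERIV_diff[OF DERIV_mult[OF 4 1] DERIV_mult[OF 3 2]], OF this]
  show ?thesis
    unfolding seg_area_def seg_area_dR_def a s_def[symmetric] .
qed

section \<open>The distribution of the distance in the intersecting regime\<close>

definition sec_radius :: "real \<Rightarrow> real \<Rightarrow> real" where
  "sec_radius \<delta> d = sqrt (d\<^sup>2 - \<delta>\<^sup>2)"

definition height1 :: "real \<Rightarrow> real \<Rightarrow> real \<Rightarrow> real \<Rightarrow> real" where
  "height1 \<delta> R\<^sub>0 R\<^sub>1 d =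
     sec_radius \<delta> d - R\<^sub>1 + (R\<^sub>0\<^sup>2 + R\<^sub>1\<^sup>2 - (sec_radius \<delta> d)\<^sup>2) / (2 * R\<^sub>1)"

definition height2 :: "real \<Rightarrow> real \<Rightarrow> real \<Rightarrow> real \<Rightarrow> real" where
  "height2 \<delta> R\<^sub>0 R\<^sub>1 d = R\<^sub>0 - (R\<^sub>0\<^sup>2 + R\<^sub>1\<^sup>2 - (sec_radius \<delta> d)\<^sup>2) / (2 * R\<^sub>1)"

definition lens_cdf :: "real \<Rightarrow> real \<Rightarrow> real \<Rightarrow> real \<Rightarrow> real" where
  "lens_cdf \<delta> R\<^sub>0 R\<^sub>1 d =
     (seg_area (sec_radius \<delta> d) (height1 \<delta> R\<^sub>0 R\<^sub>1 d) + seg_area R\<^sub>0 (height2 \<delta> R\<^sub>0 R\<^sub>1 d))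
       / (pi * R\<^sub>0\<^sup>2)"

definition lens_density :: "real \<Rightarrow> real \<Rightarrow> real \<Rightarrow> real \<Rightarrow> real" where
  "lens_density \<delta> R\<^sub>0 R\<^sub>1 d =
     1 / (pi * R\<^sub>0\<^sup>2) *
       (d / R\<^sub>1 * seg_area_dh R\<^sub>0 (height2 \<delta> R\<^sub>0 R\<^sub>1 d)
        + d / sec_radius \<delta> d * seg_area_dR (sec_radius \<delta> d) (height1 \<delta> R\<^sub>0 R\<^sub>1 d)
        + d * (1 / sec_radius \<delta> d - 1 / R\<^sub>1)
            * seg_area_dh (sec_radius \<delta> d) (height1 \<delta> R\<^sub>0 R\<^sub>1 d))"

text \<open>For \<open>R\<^sub>1 = R\<^sub>0\<close> and \<open>d = \<delta>\<close> the section radius vanishes; division by zero then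
  gives the value 0 both for the distribution function and for the density.\<close>

lemma lens_degenerate:
  assumes "0 < R\<^sub>0"
  shows "lens_cdf \<delta> R\<^sub>0 R\<^sub>0 \<delta> = 0" and "lens_density \<delta> R\<^sub>0 R\<^sub>0 \<delta> = 0"
  using assms
  by (auto simp: lens_cdf_def lens_density_def seg_area_def seg_area_dR_def seg_area_dh_def
      height1_def height2_def sec_radius_def power2_eq_square)

end

theory Submission
  imports Defs
begin

text \<open>By Pythagoras the distance from \<open>P\<close> to a point \<open>x\<close> of the plane is \<open>sqrt (\<delta>\<^sup>2 + r\<^sup>2)\<close>, where \<open>r\<close>
  is the distance from \<open>P\<^sub>0\<close> to \<open>x\<close>. So \<open>D \<le> d\<close> says that \<open>X\<close> lies in the disc of radius \<open>sec_radius \<delta> d\<close>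
  around \<open>P\<^sub>0\<close>, and the distribution function is the area of the intersection of two coplanar discs
  at distance \<open>R\<^sub>1\<close>, divided by \<open>pi * R\<^sub>0\<^sup>2\<close> (\<open>distance_law\<close>). Since the area measure of the plane can
  be computed in any isometric chart, the chart is chosen with \<open>P\<^sub>0\<close> at the origin and \<open>S\<^sub>0\<close> on the
  first axis (\<open>plane_coordinates\<close>).

  If neither disc contains the other and they meet, their common chord is perpendicular to the first
  axis and cuts the intersection into two circular segments. Integrating the lengths of the vertical
  slices on both sides of the chord gives the two values of \<open>seg_area\<close> (\<open>discs_area_lens\<close>): the slice
  length of a disc of radius \<open>R\<close> at depth \<open>h\<close> is exactly \<open>seg_area_dh R h\<close>, so \<open>seg_area R\<close> is its
  primitive. In the remaining cases the intersection is one of the discs, or empty.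

  For the density, let the moving circle have radius \<open>r\<close>, with the chord at signed distance \<open>a\<close> from
  its centre. The contributions of the moving chord to the derivatives of the two segments cancel,
  because the segments share the chord, and what is left is the length \<open>2 * r * arccos (a / r)\<close> of the
  arc inside the fixed disc (\<open>lens_area_has_derivative\<close>). In the same way the three terms of
  \<open>lens_density\<close> collapse to one that is visibly nonnegative (\<open>lens_density_arccos\<close>). Circles are null
  sets, so \<open>D\<close> has no atoms and its distribution function is continuous everywhere; it is
  differentiable with the claimed derivative except at the points \<open>\<delta>\<close>, \<open>d_min\<close> and \<open>d_max\<close>.
  The fundamental theorem of calculus then shows that the derivative is a density
  (\<open>density_of_continuous_cdf\<close>).\<close>

section \<open>Coordinates on the plane\<close>

text \<open>The planar area is transported from \<open>real^2\<close>, while slicing needs the product measure on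
  \<open>real \<times> real\<close>; this identifies the two.\<close>

lemma distr_vec2:
  "distr lborel borel (\<lambda>(x, y). x *\<^sub>R axis 1 1 + y *\<^sub>R axis 2 1 :: real^2) = lborel"
proof (rule lborel_eqI[symmetric])
  let ?g = "\<lambda>(x, y). x *\<^sub>R axis 1 1 + y *\<^sub>R axis 2 1 :: real^2"
  have [measurable]: "?g \<in> borel_measurable borel"
    by (intro borel_measurable_continuous_onI) (auto simp: case_prod_beta intro!: continuous_intros)
  have Basis: "(Basis :: (real^2) set) = {axis 1 1, axis 2 1}" "axis 1 1 \<noteq> (axis 2 1 :: real^2)"
    by (auto simp: Basis_vec_def UNIV_2 axis_eq_axis)
  fix l u :: "real^2"
  assume lu: "\<And>b. b \<in> Basis \<Longrightarrow> l \<bullet> b \<le> u \<bullet> b"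
  have le: "l $ 1 \<le> u $ 1" "l $ 2 \<le> u $ 2"
    using lu[of "axis 1 1"] lu[of "axis 2 1"] by (auto simp: Basis inner_axis)
  have "(axis 1 1 :: real^2) $ 2 = 0" "(axis 2 1 :: real^2) $ 1 = 0"
    by (simp_all add: axis_def)
  then have "?g -` box l u = {l $ 1<..<u $ 1} \<times> {l $ 2<..<u $ 2}"
    by (auto simp: box_def Basis inner_axis)
  then have "emeasure (distr lborel borel ?g) (box l u)
      = emeasure (lborel \<Otimes>\<^sub>M lborel) ({l $ 1<..<u $ 1} \<times> {l $ 2<..<u $ 2})"
    by (simp add: emeasure_distr lborel_prod)
  also have "\<dots> = ennreal ((u $ 1 - l $ 1) * (u $ 2 - l $ 2))"
    using le by (simp add: lborel.emeasure_pair_measure_Times ennreal_mult)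
  also have "\<dots> = (\<Prod>b\<in>Basis. (u - l) \<bullet> b)"
    using Basis(2) by (simp add: Basis(1) inner_axis)
  finally show "emeasure (distr lborel borel ?g) (box l u) = (\<Prod>b\<in>Basis. (u - l) \<bullet> b)" .
qed simp

lemma plane_coordinates:
  assumes Pl: "is_plane Pl" and A: "A \<in> Pl" and B: "B \<in> Pl"
  obtains \<psi> :: "real \<times> real \<Rightarrow> real^3"
  where "\<And>z w. dist (\<psi> z) (\<psi> w) = dist z w" "range \<psi> = Pl" "\<psi> (0, 0) = A"
    "\<psi> (dist A B, 0) = B" "plane_area Pl = distr lborel borel \<psi>"
proof -
  obtain \<phi> where \<phi>: "plane_chart \<phi> Pl"
    using plane_chart_exists[OF Pl] by blast
  then obtain a b where ab: "\<phi> a = A" "\<phi> b = B"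
    using A B by (auto simp: plane_chart_def image_iff)
  \<comment> \<open>A chart is fixed only up to an isometry of \<open>real^2\<close>: a translation brings \<open>A\<close> to the origin, and
    an orthogonal map turns the direction of \<open>B\<close> into the first axis.\<close>
  have "norm (dist A B *\<^sub>R axis 1 1 :: real^2) = norm (b - a)"
    using \<phi> by (simp add: ab[symmetric] plane_chart_def dist_norm norm_minus_commute)
  then obtain f :: "real^2 \<Rightarrow> real^2" where f: "orthogonal_transformation f" "f (dist A B *\<^sub>R axis 1 1) = b - a"
    using orthogonal_transformation_exists by blast
  have lin: "linear f" using f(1) by (rule orthogonal_transformation_linear)
  have surj: "surj f" using f(1) by (rule orthogonal_transformation_surj)
  define \<phi>' where "\<phi>' = (\<lambda>w. \<phi> (a + f w))"
  have \<phi>': "plane_chart \<phi>' Pl"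
    unfolding plane_chart_def
  proof (intro conjI allI)
    show "dist (\<phi>' x) (\<phi>' y) = dist x y" for x y
    proof -
      have "dist (\<phi>' x) (\<phi>' y) = dist (a + f x) (a + f y)"
        using \<phi> unfolding plane_chart_def \<phi>'_def by blast
      also have "\<dots> = dist x y"
        using f(1) unfolding orthogonal_transformation_isometry by (simp only: dist_add_cancel)
      finally show ?thesis .
    qed
    have "range \<phi>' = \<phi> ` (\<lambda>w. a + w) ` range f" by (simp add: \<phi>'_def image_image)
    also have "\<dots> = Pl" using \<phi> surj by (simp add: plane_chart_def)
    finally show "range \<phi>' = Pl" .
  qed
  let ?g = "\<lambda>(x, y). x *\<^sub>R axis 1 1 + y *\<^sub>R axis 2 1 :: real^2"
  have g_dist: "dist (?g z) (?g w) = dist z w" for z w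
    by (cases z; cases w) (simp add: dist_vec_def L2_set_def sum_2 axis_def dist_Pair_Pair)
  have "w = ?g (w $ 1, w $ 2)" for w
    by (simp add: vec_eq_iff forall_2 axis_def)
  then have g_surj: "surj ?g" by (rule surjI[OF sym])
  have [measurable]: "?g \<in> borel_measurable borel"
    by (intro borel_measurable_continuous_onI) (auto simp: case_prod_beta intro!: continuous_intros)
  have [measurable]: "\<phi>' \<in> borel_measurable borel"
    by (rule plane_chart_measurable[OF \<phi>'])
  show ?thesis
  proof
    show "dist ((\<phi>' \<circ> ?g) z) ((\<phi>' \<circ> ?g) w) = dist z w" for z w
      using \<phi>' g_dist by (simp add: plane_chart_def)
    have "range (\<phi>' \<circ> ?g) = \<phi>' ` range ?g" by (rule image_comp[symmetric])
    also have "\<dots> = Pl" using \<phi>' unfolding g_surj by (simp add: plane_chart_def)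
    finally show "range (\<phi>' \<circ> ?g) = Pl" .
    show "(\<phi>' \<circ> ?g) (0, 0) = A" "(\<phi>' \<circ> ?g) (dist A B, 0) = B"
      using f(2) ab linear_0[OF lin] by (simp_all add: \<phi>'_def)
    have "distr lborel borel (\<phi>' \<circ> ?g) = distr (distr lborel borel ?g) borel \<phi>'"
      by (subst distr_distr) auto
    then show "plane_area Pl = distr lborel borel (\<phi>' \<circ> ?g)"
      by (simp only: plane_area_eq[OF \<phi>'] distr_vec2)
  qed
qed

section \<open>The area of the intersection of two discs\<close>

lemma continuous_on_seg_area:
  assumes "0 < R"
  shows "continuous_on {0..2 * R} (seg_area R)"
  unfolding seg_area_def using assms
  by (intro continuous_intros) (auto simp: field_simps)

lemma seg_area_integral:
  assumes "0 < R" "0 \<le> h" "h \<le> 2 * R"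
  shows "(seg_area_dh R has_integral seg_area R h) {0..h}"
proof -
  have "(seg_area_dh R has_integral (seg_area R h - seg_area R 0)) {0..h}"
  proof (rule fundamental_theorem_of_calculus_interior)
    show "continuous_on {0..h} (seg_area R)"
      using assms by (intro continuous_on_subset[OF continuous_on_seg_area]) auto
    show "(seg_area R has_vector_derivative seg_area_dh R x) (at x)" if "x \<in> {0<..<h}" for x
      using seg_area_has_derivative_h[of x R] that assms
      by (simp add: has_real_derivative_iff_has_vector_derivative)
  qed (use assms in auto)
  then show ?thesis
    using assms by (simp add: seg_area_def)
qed

text \<open>Up to an isometry, the area of the intersection depends on the two radii and the distance of
  the centres only, so the centres are placed on the first axis.\<close>

definition discs_area :: "real \<Rightarrow> real \<Rightarrow> real \<Rightarrow> real" where
  "discs_area R0 R1 r = measure lborel (cball (R1, 0) R0 \<inter> cball (0, 0) r :: (real \<times> real) set)"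

lemma measure_disc:
  assumes "0 \<le> r"
  shows "measure lborel (cball c r :: (real \<times> real) set) = pi * r\<^sup>2"
  using assms content_cball[of r c] by (simp add: unit_ball_vol_2 power2_eq_square)

lemma disc_coords: "0 \<le> r \<Longrightarrow> (x, y) \<in> cball (c, 0) r \<longleftrightarrow> (x - c)\<^sup>2 + y\<^sup>2 \<le> r\<^sup>2"
  for x y c r :: real
proof -
  assume r: "0 \<le> r"
  have "dist (c, 0) (x, y) = sqrt ((x - c)\<^sup>2 + y\<^sup>2)"
    by (simp add: dist_Pair_Pair dist_real_def power2_commute)
  moreover have "sqrt s \<le> r \<longleftrightarrow> s \<le> r\<^sup>2" for s
    using real_sqrt_le_iff[of s "r\<^sup>2"] r by simp
  ultimately show ?thesis by simp
qed

text \<open>Both circles meet the line \<open>x = R1 - b\<close> in the same points, so this line carries the common chord: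
  \<open>b\<close> is the signed distance from the chord to the centre \<open>(R1, 0)\<close>. When \<open>b\<close> or \<open>R1 - b\<close> is negative,
  the corresponding segment is larger than a half disc, and its height exceeds the radius.\<close>

lemma discs_area_lens:
  assumes R0: "0 < R0" and R1: "0 < R1" and r: "0 < r"
    and lo: "\<bar>R0 - R1\<bar> \<le> r" and hi: "r \<le> R0 + R1"
  defines "b \<equiv> (R0\<^sup>2 + R1\<^sup>2 - r\<^sup>2) / (2 * R1)"
  shows "discs_area R0 R1 r = seg_area r (r - R1 + b) + seg_area R0 (R0 - b)"
proof -
  define a where "a = R1 - b"
  have ab: "2 * R1 * a = R1\<^sup>2 + r\<^sup>2 - R0\<^sup>2" "2 * R1 * b = R0\<^sup>2 + R1\<^sup>2 - r\<^sup>2"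
    using R1 by (auto simp: a_def b_def field_simps power2_eq_square)
  have sq: "(R0 - R1)\<^sup>2 \<le> r\<^sup>2" "r\<^sup>2 \<le> (R0 + R1)\<^sup>2" "(R1 - r)\<^sup>2 \<le> R0\<^sup>2" "R0\<^sup>2 \<le> (R1 + r)\<^sup>2"
    using assms by (auto intro!: power2_le_iff_abs_le[THEN iffD2] simp: abs_le_square_iff[symmetric])
  have a1: "a \<le> r" "- r \<le> a" "b \<le> R0" "- R0 \<le> b"
  proof -
    have le: "x \<le> y" if "2 * R1 * x \<le> 2 * R1 * y" for x y
      by (rule mult_left_le_imp_le[OF that]) (use R1 in simp)
    show "a \<le> r" "- r \<le> a" "b \<le> R0" "- R0 \<le> b"
      by (rule le, use ab sq in \<open>simp add: power2_eq_square algebra_simps\<close>)+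
  qed
  \<comment> \<open>The half-length of the slice at abscissa \<open>x\<close> is \<open>sqrt (m x)\<close>; which of the two discs bounds it
    changes exactly at the chord \<open>x = a\<close>.\<close>
  define m where "m x = min (r\<^sup>2 - x\<^sup>2) (R0\<^sup>2 - (x - R1)\<^sup>2)" for x
  have cmp: "(r\<^sup>2 - x\<^sup>2) - (R0\<^sup>2 - (x - R1)\<^sup>2) = 2 * R1 * (a - x)" for x
    using ab by (simp add: power2_eq_square algebra_simps)
  have m1: "m x = R0\<^sup>2 - (x - R1)\<^sup>2" if "x \<le> a" for x
  proof -
    have "0 \<le> 2 * R1 * (a - x)" using R1 that by simp
    then show ?thesis unfolding m_def cmp[symmetric] by simp
  qed
  have m2: "m x = r\<^sup>2 - x\<^sup>2" if "a \<le> x" for x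
  proof -
    have "0 \<le> 2 * R1 * (x - a)" using R1 that by simp
    then have "(r\<^sup>2 - x\<^sup>2) - (R0\<^sup>2 - (x - R1)\<^sup>2) \<le> 0" unfolding cmp by (simp add: algebra_simps)
    then show ?thesis unfolding m_def by simp
  qed
  define T :: "(real \<times> real) set" where "T = cball (R1, 0) R0 \<inter> cball (0, 0) r"
  have T: "(x, y) \<in> T \<longleftrightarrow> y\<^sup>2 \<le> m x" for x y
    using R0 r disc_coords[of R0 x y R1] disc_coords[of r x y 0]
    by (auto simp: T_def m_def simp del: mem_cball)
  define w where "w x = 2 * sqrt (max 0 (m x))" for x
  have "emeasure lborel T = (\<integral>\<^sup>+x. emeasure lborel (Pair x -` T) \<partial>lborel)"
    unfolding lborel_prod[symmetric]
    by (rule lborel.emeasure_pair_measure_alt) (subst lborel_prod, simp add: T_def)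
  also have "\<dots> = (\<integral>\<^sup>+x. ennreal (w x) \<partial>lborel)"
  proof (intro nn_integral_cong)
    fix x
    show "emeasure lborel (Pair x -` T) = ennreal (w x)"
    proof (cases "0 \<le> m x")
      case True
      have "y\<^sup>2 \<le> m x \<longleftrightarrow> - sqrt (m x) \<le> y \<and> y \<le> sqrt (m x)" for y
        using real_sqrt_le_iff[of "y\<^sup>2" "m x"] by (auto simp: abs_le_iff)
      then have "Pair x -` T = {- sqrt (m x)..sqrt (m x)}"
        by (auto simp: T)
      then show ?thesis using True by (simp add: w_def)
    next
      case False
      then have "Pair x -` T = {}"
        by (auto simp: T) (meson order_trans zero_le_power2)
      then show ?thesis using False by (simp add: w_def)
    qed
  qed
  also have "\<dots> = ennreal (seg_area r (r - a) + seg_area R0 (R0 - b))"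
  proof (rule nn_integral_has_integral_lborel)
    show "w \<in> borel_measurable borel" unfolding w_def m_def by measurable
    show "0 \<le> w x" for x by (simp add: w_def)
    \<comment> \<open>Left of the chord the depth in the disc around \<open>(R1, 0)\<close> is measured from its leftmost point
      \<open>R1 - R0\<close>, right of it the depth in the disc around the origin from its rightmost point \<open>r\<close>.\<close>
    have left: "(w has_integral seg_area R0 (R0 - b)) {R1 - R0..a}"
    proof -
      have "((\<lambda>x. seg_area_dh R0 (x + (R0 - R1))) has_integral seg_area R0 (R0 - b)) {R1 - R0..a}"
      proof -
        have "(\<lambda>x. x - (R0 - R1)) ` {0..R0 - b} = {R1 - R0..a}"
          by (simp add: a_def)
        then show ?thesis
          using has_integral_affinity[of "seg_area_dh R0" _ 0 "R0 - b" 1 "R0 - R1"]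
            seg_area_integral[OF R0, of "R0 - b"] a1 by simp
      qed
      then show ?thesis
      proof (rule has_integral_eq[rotated])
        fix x assume x: "x \<in> {R1 - R0..a}"
        then have "0 \<le> (x + (R0 - R1)) * (2 * R0 - (x + (R0 - R1)))"
          using a1 by (intro mult_nonneg_nonneg) (auto simp: a_def)
        moreover have "m x = (x + (R0 - R1)) * (2 * R0 - (x + (R0 - R1)))"
          using x m1[of x] by (simp add: power2_eq_square algebra_simps)
        ultimately show "seg_area_dh R0 (x + (R0 - R1)) = w x"
          by (simp add: seg_area_dh_def w_def)
      qed
    qed
    have right: "(w has_integral seg_area r (r - a)) {a..r}"
    proof -
      have "((\<lambda>x. seg_area_dh r (- x + r)) has_integral seg_area r (r - a)) {a..r}"
      proof -
        have "(\<lambda>x. r - x) ` {0..r - a} = {a..r}"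
          by simp
        then show ?thesis
          using has_integral_affinity[of "seg_area_dh r" _ 0 "r - a" "-1" r]
            seg_area_integral[OF r, of "r - a"] a1 by simp
      qed
      then show ?thesis
      proof (rule has_integral_eq[rotated])
        fix x assume x: "x \<in> {a..r}"
        then have "0 \<le> (- x + r) * (2 * r - (- x + r))"
          using a1 by (intro mult_nonneg_nonneg) auto
        moreover have "m x = (- x + r) * (2 * r - (- x + r))"
          using x m2[of x] by (simp add: power2_eq_square algebra_simps)
        ultimately show "seg_area_dh r (- x + r) = w x"
          by (simp add: seg_area_dh_def w_def)
      qed
    qed
    have "(w has_integral (seg_area r (r - a) + seg_area R0 (R0 - b))) {R1 - R0..r}"
      using has_integral_combine[OF _ _ left right] a1 by (simp add: a_def add.commute)
    moreover have "w x = 0" if "x \<notin> {R1 - R0..r}" for x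
    proof -
      have "m x \<le> 0"
      proof (cases "x \<le> r")
        case True
        then have "R0\<^sup>2 \<le> (x - R1)\<^sup>2"
          using that R0 by (subst abs_le_square_iff[symmetric]) auto
        then show ?thesis by (simp add: m_def)
      next
        case False
        then have "r\<^sup>2 \<le> x\<^sup>2" using r by (intro power_mono) auto
        then show ?thesis by (simp add: m_def)
      qed
      then show ?thesis by (simp add: w_def)
    qed
    ultimately show "(w has_integral (seg_area r (r - a) + seg_area R0 (R0 - b))) UNIV"
      by (rule has_integral_on_superset) auto
  qed
  finally have "emeasure lborel T = ennreal (seg_area r (r - a) + seg_area R0 (R0 - b))" .
  moreover have "0 \<le> seg_area r (r - a)" "0 \<le> seg_area R0 (R0 - b)"
    using a1 R0 r by (auto intro!: has_integral_nonneg[OF seg_area_integral] simp: seg_area_dh_def)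
  ultimately show ?thesis
    by (simp add: discs_area_def T_def measure_def a_def algebra_simps del: ennreal_plus)
qed

lemma discs_area_inside:
  assumes "0 \<le> R1" "0 \<le> r" "R1 + r \<le> R0"
  shows "discs_area R0 R1 r = pi * r\<^sup>2"
proof -
  have "(cball (0, 0) r :: (real \<times> real) set) \<subseteq> cball (R1, 0) R0"
    unfolding cball_subset_cball_iff using assms by (simp add: dist_Pair_Pair)
  then show ?thesis
    using assms by (simp add: discs_area_def measure_disc Int_absorb1 Int_absorb2)
qed

lemma discs_area_contained:
  assumes "0 \<le> R1" "0 \<le> R0" "R0 + R1 \<le> r"
  shows "discs_area R0 R1 r = pi * R0\<^sup>2"
proof -
  have "(cball (R1, 0) R0 :: (real \<times> real) set) \<subseteq> cball (0, 0) r"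
    unfolding cball_subset_cball_iff using assms by (simp add: dist_Pair_Pair)
  then show ?thesis
    using assms by (simp add: discs_area_def measure_disc Int_absorb1 Int_absorb2)
qed

lemma discs_area_disjoint:
  assumes "R0 + r < R1"
  shows "discs_area R0 R1 r = 0"
  using assms by (simp add: discs_area_def disjoint_cballI dist_Pair_Pair)

lemma discs_area_0: "discs_area R0 R1 0 = 0"
  by (simp add: discs_area_def measure_def emeasure_lborel_countable)

section \<open>The derivative of the lens area\<close>

text \<open>Both sides of the first equation are the squared half-length of the common chord. The second is
  Heron's formula for the triangle formed by the two centres and an intersection point of the circles,
  with the altitude expressed by the half-chord; it shows at once when the circles meet.\<close>

lemma chord:
  fixes R0 R1 r :: real
  assumes "0 < R1"
  defines "b \<equiv> (R0\<^sup>2 + R1\<^sup>2 - r\<^sup>2) / (2 * R1)"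
  shows chord_eq: "r\<^sup>2 - (R1 - b)\<^sup>2 = R0\<^sup>2 - b\<^sup>2"
    and chord_heron: "4 * R1\<^sup>2 * (R0\<^sup>2 - b\<^sup>2) = ((R0 + R1)\<^sup>2 - r\<^sup>2) * (r\<^sup>2 - (R0 - R1)\<^sup>2)"
proof -
  have b: "2 * R1 * b = R0\<^sup>2 + R1\<^sup>2 - r\<^sup>2" using assms by simp
  then show "r\<^sup>2 - (R1 - b)\<^sup>2 = R0\<^sup>2 - b\<^sup>2"
    by (simp add: power2_eq_square algebra_simps)
  have "4 * R1\<^sup>2 * (R0\<^sup>2 - b\<^sup>2) = 4 * R1\<^sup>2 * R0\<^sup>2 - (2 * R1 * b)\<^sup>2"
    by (simp add: power2_eq_square algebra_simps)
  also have "\<dots> = ((R0 + R1)\<^sup>2 - r\<^sup>2) * (r\<^sup>2 - (R0 - R1)\<^sup>2)"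
    unfolding b by (simp add: power2_eq_square algebra_simps)
  finally show "4 * R1\<^sup>2 * (R0\<^sup>2 - b\<^sup>2) = ((R0 + R1)\<^sup>2 - r\<^sup>2) * (r\<^sup>2 - (R0 - R1)\<^sup>2)" .
qed

text \<open>When the radius grows, the arc \<open>2 * r * arccos (a r / r)\<close> of the segment moves outward with unit
  speed, while its chord, of length \<open>2 * sqrt (r\<^sup>2 - (a r)\<^sup>2)\<close>, moves with velocity \<open>a'\<close> and eats
  into the segment.\<close>

lemma seg_area_chord_has_derivative:
  assumes a: "(a has_real_derivative a') (at r)" and r: "0 < r" "\<bar>a r\<bar> < r"
  shows "((\<lambda>r. seg_area r (r - a r)) has_real_derivative
           2 * r * arccos (a r / r) - 2 * a' * sqrt (r\<^sup>2 - (a r)\<^sup>2)) (at r)"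
proof -
  define s where "s = sqrt (r\<^sup>2 - (a r)\<^sup>2)"
  have pos: "0 < r\<^sup>2 - (a r)\<^sup>2"
    using r power_strict_mono[of "\<bar>a r\<bar>" r 2] by simp
  then have s: "0 < s" "s * s = r\<^sup>2 - (a r)\<^sup>2" by (auto simp: s_def)
  have "1 - (a r / r)\<^sup>2 = (r\<^sup>2 - (a r)\<^sup>2) / r\<^sup>2"
    using r by (simp add: field_simps)
  then have sq: "sqrt (1 - (a r / r)\<^sup>2) = s / r"
    using r by (simp add: real_sqrt_divide s_def)
  have b: "- 1 < a r / r" "a r / r < 1"
    using r by (auto simp: field_simps)
  have "((\<lambda>r. a r / r) has_real_derivative (a' * r - a r) / r\<^sup>2) (at r)"
    using r by (auto intro!: derivative_eq_intros a simp: power2_eq_square)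
  from DERIV_chain2[OF DERIV_arccos[OF b] this]
  have 1: "((\<lambda>r. arccos (a r / r)) has_real_derivative - ((a' * r - a r) / (r * s))) (at r)"
    unfolding sq by (rule DERIV_cong) (use r s in \<open>simp add: field_simps power2_eq_square\<close>)
  have "((\<lambda>r. r\<^sup>2 - (a r)\<^sup>2) has_real_derivative 2 * r - 2 * a r * a') (at r)"
    by (auto intro!: derivative_eq_intros a)
  from DERIV_chain2[OF DERIV_real_sqrt[OF pos] this]
  have 2: "((\<lambda>r. sqrt (r\<^sup>2 - (a r)\<^sup>2)) has_real_derivative (r - a r * a') / s) (at r)"
    unfolding s_def[symmetric] by (rule DERIV_cong) (use s in \<open>simp add: field_simps\<close>)
  have 3: "((\<lambda>r. r\<^sup>2) has_real_derivative 2 * r) (at r)"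
    by (auto intro!: derivative_eq_intros)
  have "2 * r * arccos (a r / r) + - ((a' * r - a r) / (r * s)) * r\<^sup>2
      - (a' * sqrt (r\<^sup>2 - (a r)\<^sup>2) + (r - a r * a') / s * a r)
      = 2 * r * arccos (a r / r) - a' * s - a' * (r\<^sup>2 - (a r)\<^sup>2) / s"
    unfolding s_def[symmetric] using r s(1) by (simp add: field_simps power2_eq_square)
  also have "\<dots> = 2 * r * arccos (a r / r) - 2 * a' * s"
    unfolding s(2)[symmetric] using s(1) by simp
  finally have eq: "2 * r * arccos (a r / r) + - ((a' * r - a r) / (r * s)) * r\<^sup>2
      - (a' * sqrt (r\<^sup>2 - (a r)\<^sup>2) + (r - a r * a') / s * a r)
      = 2 * r * arccos (a r / r) - 2 * a' * s" .
  from DERIV_cong[OF DERIV_diff[OF DERIV_mult[OF 3 1] DERIV_mult[OF a 2]] eq]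
  show ?thesis
    unfolding seg_area_def s_def by simp
qed

text \<open>The area swept by the common chord is lost by one segment and gained by the other, so only the
  moving arc contributes.\<close>

lemma lens_area_has_derivative:
  fixes R0 R1 r :: real
  assumes R0: "0 < R0" and R1: "0 < R1" and r: "\<bar>R0 - R1\<bar> < r" "r < R0 + R1"
  defines "b \<equiv> \<lambda>r. (R0\<^sup>2 + R1\<^sup>2 - r\<^sup>2) / (2 * R1)"
  shows "((\<lambda>r. seg_area r (r - R1 + b r) + seg_area R0 (R0 - b r)) has_real_derivative
           2 * r * arccos ((R1 - b r) / r)) (at r)"
proof -
  have r0: "0 < r" using r by simp
  have "0 < ((R0 + R1)\<^sup>2 - r\<^sup>2) * (r\<^sup>2 - (R0 - R1)\<^sup>2)"
  proof (rule mult_pos_pos)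
    show "0 < (R0 + R1)\<^sup>2 - r\<^sup>2"
      using r r0 power_strict_mono[of r "R0 + R1" 2] by simp
    show "0 < r\<^sup>2 - (R0 - R1)\<^sup>2"
      using r r0 power_strict_mono[of "\<bar>R0 - R1\<bar>" r 2] by simp
  qed
  then have "0 < 4 * R1\<^sup>2 * (R0\<^sup>2 - (b r)\<^sup>2)"
    by (simp only: b_def chord_heron[OF R1])
  then have pos: "0 < R0\<^sup>2 - (b r)\<^sup>2"
    using R1 by (simp add: zero_less_mult_iff)
  have eq: "r\<^sup>2 - (R1 - b r)\<^sup>2 = R0\<^sup>2 - (b r)\<^sup>2"
    using chord_eq[OF R1] by (simp add: b_def)
  have bounds: "\<bar>R1 - b r\<bar> < r" "\<bar>b r\<bar> < R0"
    using pos eq r0 R0 by (auto intro!: power2_less_imp_less[of "\<bar>_\<bar>"])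
  have db: "(b has_real_derivative - (r / R1)) (at r)"
    unfolding b_def using R1 by (auto intro!: derivative_eq_intros simp: field_simps)
  then have "((\<lambda>r. R1 - b r) has_real_derivative r / R1) (at r)"
    by (auto intro!: derivative_eq_intros)
  from seg_area_chord_has_derivative[OF this r0 bounds(1)]
  have 1: "((\<lambda>r. seg_area r (r - R1 + b r)) has_real_derivative
      2 * r * arccos ((R1 - b r) / r) - 2 * (r / R1) * sqrt (R0\<^sup>2 - (b r)\<^sup>2)) (at r)"
    by (simp add: eq diff_diff_eq2 algebra_simps)
  have "((\<lambda>r. R0 - b r) has_real_derivative r / R1) (at r)"
    using db by (auto intro!: derivative_eq_intros)
  from DERIV_chain2[OF seg_area_has_derivative_h this] bounds
  have "((\<lambda>r. seg_area R0 (R0 - b r)) has_real_derivative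
      seg_area_dh R0 (R0 - b r) * (r / R1)) (at r)"
    by auto
  moreover have "seg_area_dh R0 (R0 - b r) = 2 * sqrt (R0\<^sup>2 - (b r)\<^sup>2)"
    by (simp add: seg_area_dh_def power2_eq_square algebra_simps)
  ultimately have "((\<lambda>r. seg_area R0 (R0 - b r)) has_real_derivative
      2 * (r / R1) * sqrt (R0\<^sup>2 - (b r)\<^sup>2)) (at r)"
    by (simp add: mult_ac)
  from DERIV_add[OF 1 this] show ?thesis by simp
qed

text \<open>All roots in \<open>seg_area_dh\<close> and \<open>seg_area_dR\<close> are the same half-chord, so these terms cancel and only
  the arc remains. At section radius zero, division by zero removes the arc term as well.\<close>

lemma lens_density_arccos:
  assumes "0 < R1"
  shows "lens_density \<delta> R0 R1 d =
    (if sec_radius \<delta> d = 0 then 0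
     else 2 * d * arccos (1 - height1 \<delta> R0 R1 d / sec_radius \<delta> d) / (pi * R0\<^sup>2))"
proof -
  define r where "r = sec_radius \<delta> d"
  define b where "b = (R0\<^sup>2 + R1\<^sup>2 - r\<^sup>2) / (2 * R1)"
  define s where "s = sqrt (R0\<^sup>2 - b\<^sup>2)"
  have eq: "r\<^sup>2 - (R1 - b)\<^sup>2 = R0\<^sup>2 - b\<^sup>2"
    using chord_eq[OF assms] by (simp add: b_def)
  have h: "height1 \<delta> R0 R1 d = r - (R1 - b)" "height2 \<delta> R0 R1 d = R0 - b"
    by (simp_all add: height1_def height2_def r_def b_def)
  have "(r - (R1 - b)) * (2 * r - (r - (R1 - b))) = r\<^sup>2 - (R1 - b)\<^sup>2"
    "(R0 - b) * (2 * R0 - (R0 - b)) = R0\<^sup>2 - b\<^sup>2"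
    by (simp_all add: power2_eq_square algebra_simps)
  then have s: "sqrt (height1 \<delta> R0 R1 d * (2 * r - height1 \<delta> R0 R1 d)) = s"
    "sqrt (height2 \<delta> R0 R1 d * (2 * R0 - height2 \<delta> R0 R1 d)) = s"
    by (simp_all add: h s_def eq)
  show ?thesis
    unfolding lens_density_def seg_area_dR_def seg_area_dh_def r_def[symmetric] s
    using assms by (simp add: field_simps)
qed

lemma le_sec_radius_iff:
  assumes "0 \<le> \<delta>" "\<delta> \<le> d" "0 \<le> c"
  shows "c \<le> sec_radius \<delta> d \<longleftrightarrow> sqrt (\<delta>\<^sup>2 + c\<^sup>2) \<le> d"
    and "sec_radius \<delta> d \<le> c \<longleftrightarrow> d \<le> sqrt (\<delta>\<^sup>2 + c\<^sup>2)"
proof -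
  have "\<delta>\<^sup>2 + c\<^sup>2 \<le> d\<^sup>2 \<longleftrightarrow> sqrt (\<delta>\<^sup>2 + c\<^sup>2) \<le> d" "c\<^sup>2 \<le> d\<^sup>2 - \<delta>\<^sup>2 \<longleftrightarrow> c \<le> sqrt (d\<^sup>2 - \<delta>\<^sup>2)"
    "d\<^sup>2 \<le> \<delta>\<^sup>2 + c\<^sup>2 \<longleftrightarrow> d \<le> sqrt (\<delta>\<^sup>2 + c\<^sup>2)" "d\<^sup>2 - \<delta>\<^sup>2 \<le> c\<^sup>2 \<longleftrightarrow> sqrt (d\<^sup>2 - \<delta>\<^sup>2) \<le> c"
    using real_sqrt_le_iff[of "\<delta>\<^sup>2 + c\<^sup>2" "d\<^sup>2"] real_sqrt_le_iff[of "c\<^sup>2" "d\<^sup>2 - \<delta>\<^sup>2"]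
      real_sqrt_le_iff[of "d\<^sup>2" "\<delta>\<^sup>2 + c\<^sup>2"] real_sqrt_le_iff[of "d\<^sup>2 - \<delta>\<^sup>2" "c\<^sup>2"] assms
    by auto
  then show "c \<le> sec_radius \<delta> d \<longleftrightarrow> sqrt (\<delta>\<^sup>2 + c\<^sup>2) \<le> d"
    and "sec_radius \<delta> d \<le> c \<longleftrightarrow> d \<le> sqrt (\<delta>\<^sup>2 + c\<^sup>2)"
    unfolding sec_radius_def by linarith+
qed

lemma lens_density_nonneg:
  assumes R0: "0 < R0" and R1: "0 < R1" and d: "0 \<le> d"
    and lo: "\<bar>R0 - R1\<bar> \<le> sec_radius \<delta> d" and hi: "sec_radius \<delta> d \<le> R0 + R1"
  shows "0 \<le> lens_density \<delta> R0 R1 d"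
proof (cases "sec_radius \<delta> d = 0")
  case False
  define r where "r = sec_radius \<delta> d"
  define b where "b = (R0\<^sup>2 + R1\<^sup>2 - r\<^sup>2) / (2 * R1)"
  have r: "0 < r" "\<bar>R0 - R1\<bar> \<le> r" "r \<le> R0 + R1"
    using False lo hi by (auto simp: r_def)
  have "0 \<le> ((R0 + R1)\<^sup>2 - r\<^sup>2) * (r\<^sup>2 - (R0 - R1)\<^sup>2)"
  proof (rule mult_nonneg_nonneg)
    show "0 \<le> (R0 + R1)\<^sup>2 - r\<^sup>2"
      using r power_mono[of r "R0 + R1" 2] by simp
    show "0 \<le> r\<^sup>2 - (R0 - R1)\<^sup>2"
      using r power_mono[of "\<bar>R0 - R1\<bar>" r 2] by simp
  qed
  then have "0 \<le> 4 * R1\<^sup>2 * (r\<^sup>2 - (R1 - b)\<^sup>2)"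
    using chord_heron[OF R1, of R0 r] chord_eq[OF R1, of r R0] by (simp only: b_def)
  then have "(R1 - b)\<^sup>2 \<le> r\<^sup>2"
    using R1 by (simp add: zero_le_mult_iff)
  then have "\<bar>R1 - b\<bar> \<le> r"
    using r by (simp add: abs_le_square_iff[of _ r, simplified] abs_le_square_iff[symmetric])
  moreover have "1 - height1 \<delta> R0 R1 d / r = (R1 - b) / r"
    using r by (simp add: height1_def r_def[symmetric] b_def field_simps)
  ultimately have "0 \<le> arccos (1 - height1 \<delta> R0 R1 d / r)"
    using r by (intro arccos_lbound) (auto simp: field_simps)
  then show ?thesis
    using d by (simp add: lens_density_arccos[OF R1] r_def)
qed (simp add: lens_density_arccos[OF R1])

lemma lens_cdf_has_derivative:
  assumes R0: "0 < R0" and R1: "0 < R1" and d: "0 \<le> \<delta>" "\<delta> < d"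
    and r: "\<bar>R0 - R1\<bar> < sec_radius \<delta> d" "sec_radius \<delta> d < R0 + R1"
  shows "(lens_cdf \<delta> R0 R1 has_real_derivative lens_density \<delta> R0 R1 d) (at d)"
proof -
  define r where "r = sec_radius \<delta> d"
  define b where "b r = (R0\<^sup>2 + R1\<^sup>2 - r\<^sup>2) / (2 * R1)" for r
  have r0: "0 < r" using r by (simp add: r_def)
  have pos: "0 < d\<^sup>2 - \<delta>\<^sup>2"
    using d power_strict_mono[of \<delta> d 2] by simp
  have "((\<lambda>d. d\<^sup>2 - \<delta>\<^sup>2) has_real_derivative 2 * d) (at d)"
    by (auto intro!: derivative_eq_intros)
  from DERIV_chain2[OF DERIV_real_sqrt[OF pos] this]
  have dr: "(sec_radius \<delta> has_real_derivative d / r) (at d)"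
    unfolding r_def sec_radius_def[abs_def] by (simp add: field_simps)
  have "((\<lambda>r. seg_area r (r - R1 + b r) + seg_area R0 (R0 - b r)) has_real_derivative
      2 * r * arccos ((R1 - b r) / r)) (at r)"
    unfolding b_def using lens_area_has_derivative[OF R0 R1 r] by (simp add: r_def)
  from DERIV_cdivide[OF DERIV_chain2[OF this[unfolded r_def] dr], of "pi * R0\<^sup>2"]
  have "(lens_cdf \<delta> R0 R1 has_real_derivative
      2 * r * arccos ((R1 - b r) / r) * (d / r) / (pi * R0\<^sup>2)) (at d)"
    unfolding lens_cdf_def[abs_def] height1_def height2_def b_def r_def .
  moreover have "1 - height1 \<delta> R0 R1 d / r = (R1 - b r) / r"
    using r0 by (simp add: height1_def r_def[symmetric] b_def field_simps)
  ultimately show ?thesis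
    using r0 by (simp add: lens_density_arccos[OF R1] r_def[symmetric] mult_ac)
qed

section \<open>The law of the distance\<close>

lemma distance_law:
  fixes M :: "'a measure" and X :: "'a \<Rightarrow> real^3" and D :: "'a \<Rightarrow> real"
    and Pl S :: "(real^3) set" and S\<^sub>0 P P\<^sub>0 :: "real^3"
  assumes plane: "is_plane Pl"
    and disk: "0 < R\<^sub>0" "S\<^sub>0 \<in> Pl" "S = cball S\<^sub>0 R\<^sub>0 \<inter> Pl"
    and X: "X \<in> borel_measurable M"
    and uniform: "distr M borel X = uniform_measure (plane_area Pl) S"
    and proj: "P\<^sub>0 \<in> Pl" "\<forall>x\<in>Pl. orthogonal (P - P\<^sub>0) (x - P\<^sub>0)"
    and D: "\<forall>\<omega>. D \<omega> = norm (X \<omega> - P)"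
    and \<delta>: "\<delta> = norm (P\<^sub>0 - P)"
    and R1: "R\<^sub>1 = norm (P\<^sub>0 - S\<^sub>0)"
    and B: "B \<in> sets borel"
  shows "measure (distr M borel D) B =
    measure lborel {z \<in> cball (R\<^sub>1, 0) R\<^sub>0. sqrt (\<delta>\<^sup>2 + (norm (z :: real \<times> real))\<^sup>2) \<in> B} / (pi * R\<^sub>0\<^sup>2)"
proof -
  obtain \<psi> :: "real \<times> real \<Rightarrow> real^3"
    where iso: "\<And>z w. dist (\<psi> z) (\<psi> w) = dist z w" and range: "range \<psi> = Pl"
      and \<psi>0: "\<psi> (0, 0) = P\<^sub>0" and \<psi>1: "\<psi> (R\<^sub>1, 0) = S\<^sub>0"
      and area: "plane_area Pl = distr lborel borel \<psi>"
    using plane_coordinates[OF plane proj(1) disk(2)] unfolding R1 dist_norm by metis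
  have [measurable]: "\<psi> \<in> borel_measurable borel"
    by (rule borel_measurable_continuous_onI) (auto simp: continuous_on_iff iso)
  note [measurable] = X B
  have [measurable]: "D \<in> borel_measurable M"
    using D
    by (subst measurable_cong[where g = "\<lambda>\<omega>. norm (X \<omega> - P)"]) auto
  have pyth: "norm (\<psi> z - P) = sqrt (\<delta>\<^sup>2 + (norm z)\<^sup>2)" for z
  proof -
    have "\<psi> z \<in> Pl" using range by auto
    then have "orthogonal (\<psi> z - P\<^sub>0) (P\<^sub>0 - P)"
      using proj(2) by (auto simp: orthogonal_def inner_diff inner_commute)
    then have "(norm ((\<psi> z - P\<^sub>0) + (P\<^sub>0 - P)))\<^sup>2 = (norm (\<psi> z - P\<^sub>0))\<^sup>2 + (norm (P\<^sub>0 - P))\<^sup>2"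
      by (rule norm_add_Pythagorean)
    moreover have "norm (\<psi> z - P\<^sub>0) = norm z"
      using iso[of z "(0, 0)"] \<psi>0 by (simp only: dist_norm norm_Pair diff_zero flip: zero_prod_def)
    ultimately have "(norm (\<psi> z - P))\<^sup>2 = \<delta>\<^sup>2 + (norm z)\<^sup>2"
      by (simp add: \<delta>)
    then show ?thesis by (metis norm_ge_zero real_sqrt_unique)
  qed
  have "closed Pl"
    using plane by (auto simp: is_plane_def intro: affine_closed)
  then have S_sets [measurable]: "S \<in> sets borel"
    unfolding disk by (intro borel_closed closed_Int closed_cball)
  have S_vimage: "\<psi> -` S = cball (R\<^sub>1, 0) R\<^sub>0"
  proof (rule set_eqI)
    fix z
    have "\<psi> z \<in> Pl" using range by blast
    then show "z \<in> \<psi> -` S \<longleftrightarrow> z \<in> cball (R\<^sub>1, 0) R\<^sub>0"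
      by (simp add: disk(3) iso flip: \<psi>1)
  qed
  have "emeasure (plane_area Pl) S = emeasure lborel (cball (R\<^sub>1, 0) R\<^sub>0 :: (real \<times> real) set)"
    by (simp add: area emeasure_distr S_vimage)
  moreover have "measure lborel (cball (R\<^sub>1, 0) R\<^sub>0 :: (real \<times> real) set) = pi * R\<^sub>0\<^sup>2"
    using disk(1) by (simp add: measure_disc)
  moreover have "emeasure lborel (cball (R\<^sub>1, 0) R\<^sub>0 :: (real \<times> real) set) < \<infinity>"
    by (rule emeasure_lborel_cball_finite)
  ultimately have S: "emeasure (plane_area Pl) S \<noteq> 0" "emeasure (plane_area Pl) S \<noteq> \<infinity>"
    "measure (plane_area Pl) S = pi * R\<^sub>0\<^sup>2"
    using disk(1) by (auto simp: measure_def)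
  define E where "E = {x. norm (x - P) \<in> B}"
  have [measurable]: "E \<in> sets borel"
    unfolding E_def by measurable
  have "measure (distr M borel D) B = measure (distr M borel X) E"
    by (subst (1 2) measure_distr) (auto intro!: arg_cong[where f = "measure M"] simp: E_def D)
  also have "\<dots> = measure (plane_area Pl) (S \<inter> E) / (pi * R\<^sub>0\<^sup>2)"
    unfolding uniform using S by (simp add: area)
  also have "measure (plane_area Pl) (S \<inter> E) = measure lborel (\<psi> -` (S \<inter> E))"
    by (simp add: area measure_distr)
  also have "\<psi> -` (S \<inter> E) = {z \<in> cball (R\<^sub>1, 0) R\<^sub>0. sqrt (\<delta>\<^sup>2 + (norm z)\<^sup>2) \<in> B}"
    using S_vimage by (auto simp: E_def pyth)
  finally show ?thesis .
qed

text \<open>The circle at a given distance is a null set, so the distance has no atoms.\<close>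

lemma circle_section_null:
  "measure lborel {z \<in> cball c R. sqrt (\<delta>\<^sup>2 + (norm (z :: real \<times> real))\<^sup>2) \<in> {x}} = 0"
proof -
  have "sphere 0 (sqrt (x\<^sup>2 - \<delta>\<^sup>2)) \<in> null_sets (lebesgue :: (real \<times> real) measure)"
    using negligible_sphere by (simp add: negligible_iff_null_sets)
  then have "sphere 0 (sqrt (x\<^sup>2 - \<delta>\<^sup>2)) \<in> null_sets (lborel :: (real \<times> real) measure)"
    by (simp add: null_sets_completion_iff)
  then have "{z \<in> cball c R. sqrt (\<delta>\<^sup>2 + (norm (z :: real \<times> real))\<^sup>2) \<in> {x}} \<in> null_sets lborel"
  proof (rule null_sets_subset)
    have "norm z = sqrt ((sqrt (\<delta>\<^sup>2 + (norm z)\<^sup>2))\<^sup>2 - \<delta>\<^sup>2)" for z :: "real \<times> real"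
      by simp
    then show "{z \<in> cball c R. sqrt (\<delta>\<^sup>2 + (norm (z :: real \<times> real))\<^sup>2) \<in> {x}} \<subseteq> sphere 0 (sqrt (x\<^sup>2 - \<delta>\<^sup>2))"
      by auto
    have "{z \<in> cball c R. sqrt (\<delta>\<^sup>2 + (norm (z :: real \<times> real))\<^sup>2) \<in> {x}}
        = cball c R \<inter> {z. sqrt (\<delta>\<^sup>2 + (norm z)\<^sup>2) = x}"
      by blast
    also have "closed \<dots>"
      by (intro closed_Int closed_cball closed_Collect_eq continuous_intros)
    finally show "{z \<in> cball c R. sqrt (\<delta>\<^sup>2 + (norm (z :: real \<times> real))\<^sup>2) \<in> {x}} \<in> sets lborel"
      unfolding sets_lborel by (rule borel_closed)
  qed
  then show ?thesis by (simp add: measure_eq_0_null_sets)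
qed

section \<open>Densities from continuous distribution functions\<close>

text \<open>Measurability of \<open>f\<close> comes for free, since a derivative is a limit of difference quotients, and
  integrability follows from nonnegativity. Since no mass lies below \<open>a\<close>, each half-line
  can be replaced by a compact interval, to which the fundamental theorem of calculus applies.\<close>

lemma density_of_continuous_cdf:
  fixes D :: "'a \<Rightarrow> real"
  assumes "prob_space M" "D \<in> borel_measurable M"
    and cont: "\<And>x. isCont (cdf (distr M borel D)) x"
    and nonneg: "\<And>x. 0 \<le> f x"
    and zero: "\<And>x. x \<le> a \<Longrightarrow> cdf (distr M borel D) x = 0" "\<And>x. x < a \<Longrightarrow> f x = 0"
    and K: "finite K"
    and deriv: "\<And>x. x \<notin> K \<Longrightarrow> (cdf (distr M borel D) has_real_derivative f x) (at x)"
  shows "is_density_of M D f"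
proof -
  interpret prob_space M by fact
  let ?F = "cdf (distr M borel D)"
  have contF: "continuous_on A ?F" for A
    using cont by (simp add: continuous_at_imp_continuous_on)
  have [measurable]: "?F \<in> borel_measurable borel"
    by (rule borel_measurable_continuous_onI[OF contF])
  \<comment> \<open>Off \<open>K\<close>, the function \<open>f\<close> is a pointwise limit of difference quotients, hence measurable.\<close>
  define q where "q n x = (?F (x + 1 / real (Suc n)) - ?F x) / (1 / real (Suc n))" for n x
  have [measurable]: "q n \<in> borel_measurable borel" for n
    unfolding q_def by measurable
  have lim: "(\<lambda>n. q n x) \<longlonglongrightarrow> f x" if "x \<notin> K" for x
  proof -
    have "((\<lambda>h. (?F (x + h) - ?F x) / h) \<longlongrightarrow> f x) (at 0)"
      using deriv[OF that] by (simp add: DERIV_def)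
    moreover have "filterlim (\<lambda>n. 1 / real (Suc n)) (at 0) sequentially"
      by (rule filterlim_atI) (use LIMSEQ_inverse_real_of_nat in \<open>auto simp: inverse_eq_divide\<close>)
    ultimately show ?thesis
      unfolding q_def by (rule filterlim_compose)
  qed
  define f0 where "f0 x = (if x \<in> K then 0 else f x)" for x
  have "(\<lambda>x. f0 x) \<in> borel_measurable borel"
  proof (rule borel_measurable_LIMSEQ_real)
    show "(\<lambda>n. if x \<in> K then 0 else q n x) \<longlonglongrightarrow> f0 x" for x
      using lim[of x] by (auto simp: f0_def)
    have [measurable]: "K \<in> sets borel" by (intro borel_closed finite_imp_closed K)
    show "(\<lambda>x. if x \<in> K then 0 else q n x) \<in> borel_measurable borel" for n
      by measurable
  qed
  then have f_meas [measurable]: "f \<in> borel_measurable borel"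
    by (rule measurable_discrete_difference[where X = K])
       (auto simp: f0_def K countable_finite)
  have "set_integrable lborel {..d} f \<and> ?F d = (LBINT t:{..d}. f t)" for d
  proof -
    have "((\<lambda>t. if t \<in> {..d} then f t else 0) has_integral ?F d) UNIV"
    proof (cases "a \<le> d")
      case True
      have "(f has_integral (?F d - ?F a)) {a..d}"
        using deriv by (intro fundamental_theorem_of_calculus_interior_strong[OF K True] contF)
          (auto simp: has_real_derivative_iff_has_vector_derivative)
      then have "((\<lambda>t. if t \<in> {a..d} then f t else 0) has_integral ?F d) UNIV"
        by (simp only: zero(1) has_integral_restrict_UNIV) simp
      also have "(\<lambda>t. if t \<in> {a..d} then f t else 0) = (\<lambda>t. if t \<in> {..d} then f t else 0)"
        by (auto simp: fun_eq_iff zero(2))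
      finally show ?thesis .
    next
      case False
      then have "(\<lambda>t. if t \<in> {..d} then f t else 0) = (\<lambda>t. 0)" "?F d = 0"
        by (auto simp: fun_eq_iff zero)
      then show ?thesis by simp
    qed
    then have "(\<integral>\<^sup>+t. ennreal (if t \<in> {..d} then f t else 0) \<partial>lborel) = ennreal (?F d)"
      by (intro nn_integral_has_integral_lborel) (auto simp: nonneg)
    then have "has_bochner_integral lborel (\<lambda>t. if t \<in> {..d} then f t else 0) (?F d)"
      by (intro has_bochner_integral_nn_integral) (auto simp: nonneg cdf_def)
    moreover have "(\<lambda>t. if t \<in> {..d} then f t else 0) = (\<lambda>t. indicat_real {..d} t *\<^sub>R f t)"
      by (auto simp: fun_eq_iff indicator_def)
    ultimately show ?thesis
      by (auto simp: set_integrable_def set_lebesgue_integral_def has_bochner_integral_iff)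
  qed
  then show ?thesis
    by (simp add: is_density_of_def nonneg)
qed

section \<open>Distribution function and density of the distance\<close>

theorem mainTheorem1:
  fixes M :: "'a measure" and X :: "'a \<Rightarrow> real^3" and D :: "'a \<Rightarrow> real"
    and Pl S :: "(real^3) set" and S\<^sub>0 P P\<^sub>0 :: "real^3"
    and R\<^sub>0 R\<^sub>1 \<delta> d_min d_max :: real
  assumes plane: "is_plane Pl"
    and disk: "0 < R\<^sub>0" "S\<^sub>0 \<in> Pl" "S = cball S\<^sub>0 R\<^sub>0 \<inter> Pl"
    and prob: "prob_space M" "X \<in> borel_measurable M"
    and uniform: "distr M borel X = uniform_measure (plane_area Pl) S"
    and proj: "P\<^sub>0 \<in> Pl" "\<forall>x\<in>Pl. orthogonal (P - P\<^sub>0) (x - P\<^sub>0)"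
    and D: "\<forall>\<omega>. D \<omega> = norm (X \<omega> - P)"
    and \<delta>: "\<delta> = norm (P\<^sub>0 - P)"
    and R1: "R\<^sub>1 = norm (P\<^sub>0 - S\<^sub>0)"
    and d_min: "d_min = sqrt (\<delta>\<^sup>2 + (R\<^sub>0 - R\<^sub>1)\<^sup>2)"
    and d_max: "d_max = sqrt (\<delta>\<^sup>2 + (R\<^sub>0 + R\<^sub>1)\<^sup>2)"
  shows "(R\<^sub>1 = 0 \<longrightarrow>
            cdf (distr M borel D) =
              (\<lambda>d. if d < \<delta> then 0
                   else if d \<le> sqrt (\<delta>\<^sup>2 + R\<^sub>0\<^sup>2) then (d\<^sup>2 - \<delta>\<^sup>2) / R\<^sub>0\<^sup>2
                   else 1)
          \<and> is_density_of M D
              (\<lambda>d. if d < \<delta> then 0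
                   else if d \<le> sqrt (\<delta>\<^sup>2 + R\<^sub>0\<^sup>2) then 2 * d / R\<^sub>0\<^sup>2
                   else 0))
       \<and> (0 < R\<^sub>1 \<and> R\<^sub>1 < R\<^sub>0 \<longrightarrow>
            cdf (distr M borel D) =
              (\<lambda>d. if d < \<delta> then 0
                   else if d \<le> d_min then (d\<^sup>2 - \<delta>\<^sup>2) / R\<^sub>0\<^sup>2
                   else if d \<le> d_max then lens_cdf \<delta> R\<^sub>0 R\<^sub>1 d
                   else 1)
          \<and> is_density_of M D
              (\<lambda>d. if d < \<delta> then 0
                   else if d \<le> d_min then 2 * d / R\<^sub>0\<^sup>2
                   else if d \<le> d_max then lens_density \<delta> R\<^sub>0 R\<^sub>1 d
                   else 0))
       \<and> (R\<^sub>0 \<le> R\<^sub>1 \<longrightarrow>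
            cdf (distr M borel D) =
              (\<lambda>d. if d < d_min then 0
                   else if d \<le> d_max then lens_cdf \<delta> R\<^sub>0 R\<^sub>1 d
                   else 1)
          \<and> is_density_of M D
              (\<lambda>d. if d < d_min then 0
                   else if d \<le> d_max then lens_density \<delta> R\<^sub>0 R\<^sub>1 d
                   else 0))"
proof -
  interpret prob_space M by (rule prob(1))
  let ?F = "cdf (distr M borel D)"
  let ?r = "sec_radius \<delta>"
  have D_meas: "D \<in> borel_measurable M"
    using prob(2) D by (subst measurable_cong[where g = "\<lambda>\<omega>. norm (X \<omega> - P)"]) auto
  interpret D: real_distribution "distr M borel D"
    using D_meas by (rule real_distribution_distr)
  note law = distance_law[OF plane disk prob(2) uniform proj D \<delta> R1]
  have cont: "isCont ?F d" for d
    using law[of "{d}"] unfolding D.isCont_cdf circle_section_null by simp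
  have nonneg: "0 \<le> \<delta>" "0 \<le> R\<^sub>1" by (simp_all add: \<delta> R1)
  have sqrt_ge: "\<delta> \<le> sqrt (\<delta>\<^sup>2 + c\<^sup>2)" for c
    using nonneg by (intro real_le_rsqrt) simp
  have min_ge: "\<delta> \<le> d_min" unfolding d_min by (rule sqrt_ge)
  have "(R\<^sub>0 - R\<^sub>1)\<^sup>2 \<le> (R\<^sub>0 + R\<^sub>1)\<^sup>2"
    using disk(1) nonneg by (simp add: power2_eq_square algebra_simps)
  then have min_max: "d_min \<le> d_max" by (simp add: d_min d_max)
  have min_le_iff: "d_min \<le> d \<longleftrightarrow> \<bar>R\<^sub>0 - R\<^sub>1\<bar> \<le> ?r d" "d \<le> d_min \<longleftrightarrow> ?r d \<le> \<bar>R\<^sub>0 - R\<^sub>1\<bar>" if "\<delta> \<le> d" for d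
    using le_sec_radius_iff[OF nonneg(1) that, of "\<bar>R\<^sub>0 - R\<^sub>1\<bar>"] by (simp_all add: d_min)
  have max_le_iff: "d_max \<le> d \<longleftrightarrow> R\<^sub>0 + R\<^sub>1 \<le> ?r d" "d \<le> d_max \<longleftrightarrow> ?r d \<le> R\<^sub>0 + R\<^sub>1" if "\<delta> \<le> d" for d
    using le_sec_radius_iff[OF nonneg(1) that, of "R\<^sub>0 + R\<^sub>1"] disk(1) nonneg by (simp_all add: d_max)
  have r_nonneg: "0 \<le> ?r d" if "\<delta> \<le> d" for d
    using that nonneg by (simp add: sec_radius_def power_mono)
  have r_sq: "(?r d)\<^sup>2 = d\<^sup>2 - \<delta>\<^sup>2" if "\<delta> \<le> d" for d
    using that nonneg by (simp add: sec_radius_def power_mono)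

  have F_below: "?F d = 0" if "d < \<delta>" for d
  proof -
    have empty: "{z \<in> cball (R\<^sub>1, 0) R\<^sub>0. sqrt (\<delta>\<^sup>2 + (norm (z :: real \<times> real))\<^sup>2) \<in> {..d}} = {}"
      using that sqrt_ge by (auto simp: not_le intro: less_le_trans)
    show ?thesis
      using law[of "{..d}"] unfolding cdf_def empty by simp
  qed
  have F: "?F d = discs_area R\<^sub>0 R\<^sub>1 (?r d) / (pi * R\<^sub>0\<^sup>2)" if "\<delta> \<le> d" for d
  proof -
    have "z \<in> cball (0, 0) (?r d) \<longleftrightarrow> sqrt (\<delta>\<^sup>2 + (norm z)\<^sup>2) \<in> {..d}" for z :: "real \<times> real"
      using le_sec_radius_iff(1)[OF nonneg(1) that, of "norm z"] by (simp flip: zero_prod_def)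
    then have inter: "{z \<in> cball (R\<^sub>1, 0) R\<^sub>0. sqrt (\<delta>\<^sup>2 + (norm (z :: real \<times> real))\<^sup>2) \<in> {..d}}
        = cball (R\<^sub>1, 0) R\<^sub>0 \<inter> cball (0, 0) (?r d)"
      by blast
    show ?thesis
      using law[of "{..d}"] unfolding cdf_def discs_area_def inter by simp
  qed
  have F_le: "?F d = 0" if "d \<le> \<delta>" for d
    using F_below[of d] F[of \<delta>] that by (cases "d = \<delta>") (auto simp: sec_radius_def discs_area_0)
  have F_inside: "?F d = (d\<^sup>2 - \<delta>\<^sup>2) / R\<^sub>0\<^sup>2" if "R\<^sub>1 \<le> R\<^sub>0" "\<delta> \<le> d" "d \<le> d_min" for d
    using that nonneg r_nonneg[of d] disk(1)
    by (simp add: F min_le_iff discs_area_inside r_sq)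
  have F_disjoint: "?F d = 0" if "R\<^sub>0 \<le> R\<^sub>1" "d < d_min" for d
  proof (cases "d < \<delta>")
    case False
    with that min_le_iff(1)[of d] show ?thesis by (simp add: F discs_area_disjoint)
  qed (rule F_below)
  have F_above: "?F d = 1" if "d_max \<le> d" for d
    using that nonneg disk(1) min_ge min_max max_le_iff(1)[of d]
    by (simp add: F discs_area_contained)
  have F_lens: "?F d = lens_cdf \<delta> R\<^sub>0 R\<^sub>1 d" if "0 < R\<^sub>1" "d_min \<le> d" "d \<le> d_max" for d
    \<comment> \<open>Radius zero occurs here only for \<open>R\<^sub>1 = R\<^sub>0\<close> and \<open>d = \<delta>\<close>, where division by zero makes
      \<open>lens_cdf\<close> vanish, as it should.\<close>
  proof (cases "?r d = 0")
    case True
    have d: "\<delta> \<le> d" using that min_ge by simp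
    have "R\<^sub>1 = R\<^sub>0" using True that(2) min_le_iff[OF d] by simp
    moreover have "d = \<delta>"
      using True r_sq[OF d] nonneg d by (metis eq_iff_diff_eq_0 order_trans power2_eq_iff_nonneg zero_power2)
    ultimately show ?thesis
      using F_le[of d] lens_degenerate(1)[OF disk(1)] by simp
  next
    case False
    have d: "\<delta> \<le> d" using that min_ge by simp
    then show ?thesis
      using that False r_nonneg[OF d] disk(1)
      by (simp add: F min_le_iff max_le_iff discs_area_lens lens_cdf_def height1_def height2_def)
  qed

  have deriv_below: "(?F has_real_derivative 0) (at d)" if "d < \<delta>" for d
    by (rule has_field_derivative_transform_within_open[where S = "{..<\<delta>}" and f = "\<lambda>_. 0"])
      (use that F_below in auto)
  have deriv_inside: "(?F has_real_derivative 2 * d / R\<^sub>0\<^sup>2) (at d)"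
    if "R\<^sub>1 \<le> R\<^sub>0" "\<delta> < d" "d < d_min" for d
  proof (rule has_field_derivative_transform_within_open[where S = "{\<delta><..<d_min}"])
    show "((\<lambda>d. (d\<^sup>2 - \<delta>\<^sup>2) / R\<^sub>0\<^sup>2) has_real_derivative 2 * d / R\<^sub>0\<^sup>2) (at d)"
      by (rule DERIV_cdivide) (auto intro!: derivative_eq_intros)
  qed (use that F_inside in auto)
  have deriv_disjoint: "(?F has_real_derivative 0) (at d)" if "R\<^sub>0 \<le> R\<^sub>1" "d < d_min" for d
    by (rule has_field_derivative_transform_within_open[where S = "{..<d_min}" and f = "\<lambda>_. 0"])
      (use that F_disjoint in auto)
  have deriv_above: "(?F has_real_derivative 0) (at d)" if "d_max < d" for d
    by (rule has_field_derivative_transform_within_open[where S = "{d_max<..}" and f = "\<lambda>_. 1"])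
      (use that F_above in auto)
  have deriv_lens: "(?F has_real_derivative lens_density \<delta> R\<^sub>0 R\<^sub>1 d) (at d)"
    if "0 < R\<^sub>1" "d_min < d" "d < d_max" for d
  proof (rule has_field_derivative_transform_within_open[where S = "{d_min<..<d_max}"])
    show "(lens_cdf \<delta> R\<^sub>0 R\<^sub>1 has_real_derivative lens_density \<delta> R\<^sub>0 R\<^sub>1 d) (at d)"
      using that min_ge nonneg disk(1) min_le_iff(2)[of d] max_le_iff(1)[of d]
      by (intro lens_cdf_has_derivative) auto
  qed (use that F_lens in auto)
  have density_nonneg: "0 \<le> lens_density \<delta> R\<^sub>0 R\<^sub>1 d" if "0 < R\<^sub>1" "d_min \<le> d" "d \<le> d_max" for d
    using that min_ge nonneg disk(1) min_le_iff(1)[of d] max_le_iff(2)[of d]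
    by (intro lens_density_nonneg) auto
  note densityI = density_of_continuous_cdf[OF prob(1) D_meas cont _ F_le, where K = "{\<delta>, d_min, d_max}"]

  show ?thesis
  proof (intro conjI impI)
    assume R1_0: "R\<^sub>1 = 0"
    then have ends: "d_min = sqrt (\<delta>\<^sup>2 + R\<^sub>0\<^sup>2)" "d_max = sqrt (\<delta>\<^sup>2 + R\<^sub>0\<^sup>2)"
      by (simp_all add: d_min d_max)
    \<comment> \<open>For concentric discs the regime of overlapping circles is the single point \<open>d_min = d_max\<close>.\<close>
    note in_max = F_inside[unfolded ends] and ab = F_above[unfolded ends]
    show "?F = (\<lambda>d. if d < \<delta> then 0
                   else if d \<le> sqrt (\<delta>\<^sup>2 + R\<^sub>0\<^sup>2) then (d\<^sup>2 - \<delta>\<^sup>2) / R\<^sub>0\<^sup>2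
                   else 1)"
      using F_below in_max ab R1_0 disk(1) by (auto simp: fun_eq_iff)
    show "is_density_of M D
              (\<lambda>d. if d < \<delta> then 0
                   else if d \<le> sqrt (\<delta>\<^sup>2 + R\<^sub>0\<^sup>2) then 2 * d / R\<^sub>0\<^sup>2
                   else 0)"
      by (rule densityI; (simp add: ends[symmetric])?)
        (use nonneg deriv_below deriv_inside deriv_above R1_0 disk(1) ends min_ge in \<open>auto simp: not_less\<close>)
  next
    assume R: "0 < R\<^sub>1 \<and> R\<^sub>1 < R\<^sub>0"
    show "?F = (\<lambda>d. if d < \<delta> then 0
                   else if d \<le> d_min then (d\<^sup>2 - \<delta>\<^sup>2) / R\<^sub>0\<^sup>2
                   else if d \<le> d_max then lens_cdf \<delta> R\<^sub>0 R\<^sub>1 d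
                   else 1)"
      using F_below F_inside F_lens F_above R by (auto simp: fun_eq_iff)
    show "is_density_of M D
              (\<lambda>d. if d < \<delta> then 0
                   else if d \<le> d_min then 2 * d / R\<^sub>0\<^sup>2
                   else if d \<le> d_max then lens_density \<delta> R\<^sub>0 R\<^sub>1 d
                   else 0)"
      by (rule densityI)
        (use nonneg deriv_below deriv_inside deriv_lens deriv_above density_nonneg R min_ge in auto)
  next
    assume R: "R\<^sub>0 \<le> R\<^sub>1"
    then have R1_pos: "0 < R\<^sub>1" using disk(1) by simp
    show "?F = (\<lambda>d. if d < d_min then 0
                   else if d \<le> d_max then lens_cdf \<delta> R\<^sub>0 R\<^sub>1 d
                   else 1)"
      using F_disjoint[OF R] F_lens[OF R1_pos] F_above by (auto simp: fun_eq_iff)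
    show "is_density_of M D
              (\<lambda>d. if d < d_min then 0
                   else if d \<le> d_max then lens_density \<delta> R\<^sub>0 R\<^sub>1 d
                   else 0)"
      by (rule densityI)
        (use deriv_disjoint[OF R] deriv_lens[OF R1_pos] deriv_above density_nonneg[OF R1_pos] min_ge in auto)
  qed
qed

end
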